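(* Let $R$ be a residually solvable Leibniz algebra over $\mathbb{C}$ whose maximal by inclusion pro-nilpotent ideal is $F$, with $F$ of codimension $2$ in $R$. Then $R$ admits a basis $\{x,y,e_1,e_2,\dots\}$ on which its multiplication table has the form $$R(F,2,\beta):\quad [e_i,e_1]=e_{i+1}\ (i\ge 2),\quad [e_1,x]=-[x,e_1]=e_1,\quad [e_i,x]=(i-2)e_i+\sum_{k=2}^{t}\beta_k e_{k+i-2}\ (i\ge 2),\quad [e_i,y]=e_i\ (i\ge 2),$$ where $\beta=(\beta_2,\beta_3,\dots,\beta_t)\in\mathbb{C}^{t-1}$ for some $t\in\mathbb{N}$.
   Context: All algebras are over $\mathbb{C}$ and have a countable basis, every element being a finite linear combination of basis elements. A Leibniz algebra is an algebra with bilinear product $[\cdot,\cdot]$ satisfying $[a,[b,c]]=[[a,b],c]-[[a,c],b]$ for all $a,b,c$. In multiplication tables of Leibniz algebras, products of basis elements that are not listed are zero (no antisymmetry is assumed); empty sums are zero. $F$ is the infinite-dimensional Leibniz algebra with basis $\{e_1,e_2,\dots\}$ and only nonzero products $[e_i,e_1]=e_{i+1}$ for $i\ge 2$. For an algebra $L$, set $L^1=L$, $L^{k+1}=[L^k,L]$ and $L^{[1]}=L$, $L^{[s+1]}=[L^{[s]},L^{[s]}]$. $L$ is residually solvable if $\bigcap_{i\ge1}L^{[i]}=0$. $L$ is pro-nilpotent if $\bigcap_{i\ge1}L^{i}=0$ and $\dim(L/L^i)<\infty$ for all $i\ge 1$. "The maximal by inclusion pro-nilpotent ideal of $R$ is $F$"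 means that $F$ is (isomorphic to) an ideal of $R$ that is maximal with respect to inclusion among pro-nilpotent ideals of $R$. *)

theory Defs
  imports Complex_Main "HOL-Library.Countable_Set"
begin

locale complex_algebra = vector_space scale
  for scale :: "complex \<Rightarrow> 'a::ab_group_add \<Rightarrow> 'a" (infixr \<open>*s\<close> 75) +
  fixes bracket :: "'a \<Rightarrow> 'a \<Rightarrow> 'a" (\<open>\<lbrakk>_,/ _\<rbrakk>\<close>)
  assumes bracket_linear_left: "Vector_Spaces.linear scale scale (\<lambda>a. \<lbrakk>a, b\<rbrakk>)"
    and bracket_linear_right: "Vector_Spaces.linear scale scale (\<lambda>b. \<lbrakk>a, b\<rbrakk>)"
    and countable_basis: "\<exists>B. countable B \<and> independent B \<and> span B = UNIV"
begin

definition bracket_span :: "'a set \<Rightarrow> 'a set \<Rightarrow> 'a set"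
  where "bracket_span A B = span {\<lbrakk>a, b\<rbrakk> | a b. a \<in> A \<and> b \<in> B}"

(* The series are indexed from 0: "lower_central L k" is L^(k+1), and
   "derived L k" is L^[k+1]. *)
primrec lower_central :: "'a set \<Rightarrow> nat \<Rightarrow> 'a set"
  where
    "lower_central L 0 = L"
  | "lower_central L (Suc k) = bracket_span (lower_central L k) L"

primrec derived :: "'a set \<Rightarrow> nat \<Rightarrow> 'a set"
  where
    "derived L 0 = L"
  | "derived L (Suc k) = bracket_span (derived L k) (derived L k)"

definition ideal :: "'a set \<Rightarrow> bool"
  where "ideal J \<longleftrightarrow> subspace J \<and> (\<forall>a\<in>J. \<forall>r. \<lbrakk>a, r\<rbrakk> \<in> J \<and> \<lbrakk>r, a\<rbrakk> \<in> J)"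

(* dim (V/S) = n for subspaces S \<subseteq> V: the classes modulo S of the n elements
   of B form a basis of the quotient space V/S. *)
definition has_codim :: "'a set \<Rightarrow> 'a set \<Rightarrow> nat \<Rightarrow> bool"
  where "has_codim S V n \<longleftrightarrow>
    (\<exists>B. B \<subseteq> V \<and> finite B \<and> card B = n \<and> span (S \<union> B) = V \<and>
         (\<forall>c. (\<Sum>b\<in>B. c b *s b) \<in> S \<longrightarrow> (\<forall>b\<in>B. c b = 0)))"

definition residually_solvable :: "'a set \<Rightarrow> bool"
  where "residually_solvable L \<longleftrightarrow> (\<Inter>k. derived L k) = {0}"

definition pro_nilpotent :: "'a set \<Rightarrow> bool"
  where "pro_nilpotent L \<longleftrightarrow>
    (\<Inter>k. lower_central L k) = {0} \<and> (\<forall>k. \<exists>n. has_codim (lower_central L k) L n)"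

definition maximal_pro_nilpotent_ideal :: "'a set \<Rightarrow> bool"
  where "maximal_pro_nilpotent_ideal N \<longleftrightarrow>
    ideal N \<and> pro_nilpotent N \<and>
    (\<forall>J. ideal J \<and> pro_nilpotent J \<and> N \<subseteq> J \<longrightarrow> J = N)"

(* The subalgebra N is a copy of F: it has a basis e 1, e 2, ... (the value e 0
   is irrelevant) whose multiplication table is that of F. *)
definition isomorphic_to_F :: "'a set \<Rightarrow> bool"
  where "isomorphic_to_F N \<longleftrightarrow>
    (\<exists>e :: nat \<Rightarrow> 'a.
       inj_on e {1..} \<and> independent (e ` {1..}) \<and> span (e ` {1..}) = N \<and>
       (\<forall>i\<ge>1. \<forall>j\<ge>1. \<lbrakk>e i, e j\<rbrakk> = (if i \<ge> 2 \<and> j = 1 then e (i + 1) else 0)))"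

(* {x, y, e 1, e 2, ...} is a basis of the whole algebra, without repetitions, on
   which the products are those of R(F,2,(\<beta> 2, ..., \<beta> t)); the products missing
   from the usual multiplication table are stated to be zero. *)
definition has_R_F_2_table ::
    "nat \<Rightarrow> (nat \<Rightarrow> complex) \<Rightarrow> 'a \<Rightarrow> 'a \<Rightarrow> (nat \<Rightarrow> 'a) \<Rightarrow> bool"
  where "has_R_F_2_table t \<beta> x y e \<longleftrightarrow>
    x \<noteq> y \<and> x \<notin> e ` {1..} \<and> y \<notin> e ` {1..} \<and> inj_on e {1..} \<and>
    independent ({x, y} \<union> e ` {1..}) \<and> span ({x, y} \<union> e ` {1..}) = UNIV \<and>
    (\<forall>i\<ge>1. \<forall>j\<ge>1. \<lbrakk>e i, e j\<rbrakk> = (if i \<ge> 2 \<and> j = 1 then e (i + 1) else 0)) \<and>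
    \<lbrakk>e 1, x\<rbrakk> = e 1 \<and> \<lbrakk>x, e 1\<rbrakk> = - e 1 \<and>
    (\<forall>i\<ge>2. \<lbrakk>e i, x\<rbrakk> = (of_nat i - 2) *s e i + (\<Sum>k=2..t. \<beta> k *s e (k + i - 2))) \<and>
    (\<forall>i\<ge>2. \<lbrakk>e i, y\<rbrakk> = e i) \<and>
    \<lbrakk>e 1, y\<rbrakk> = 0 \<and> (\<forall>i\<ge>2. \<lbrakk>x, e i\<rbrakk> = 0) \<and> (\<forall>i\<ge>1. \<lbrakk>y, e i\<rbrakk> = 0) \<and>
    \<lbrakk>x, x\<rbrakk> = 0 \<and> \<lbrakk>x, y\<rbrakk> = 0 \<and> \<lbrakk>y, x\<rbrakk> = 0 \<and> \<lbrakk>y, y\<rbrakk> = 0"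

end

locale leibniz_algebra = complex_algebra +
  assumes leibniz: "\<lbrakk>a, \<lbrakk>b, c\<rbrakk>\<rbrakk> = \<lbrakk>\<lbrakk>a, b\<rbrakk>, c\<rbrakk> - \<lbrakk>\<lbrakk>a, c\<rbrakk>, b\<rbrakk>"

end

theory Submission
  imports Defs "HOL-Computational_Algebra.Polynomial"
begin

text \<open>
  Write the span \<open>V\<close> of \<open>e\<^sub>2, e\<^sub>3, \<dots>\<close> as the polynomial space \<open>\<complex>[X]\<close>, with
  \<open>e\<^sub>i\<close> corresponding to \<open>X\<^sup>i\<^sup>-\<^sup>2\<close>. Then right multiplication by \<open>e\<^sub>1\<close> is
  multiplication by \<open>X\<close>. Right multiplications in a Leibniz algebra are derivations, and
  a derivation of \<open>F\<close> is determined by its values on \<open>e\<^sub>1\<close> and \<open>e\<^sub>2\<close>: every \<open>r\<close> in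
  \<open>R\<close> sends \<open>e\<^sub>1\<close> to \<open>w e\<^sub>1\<close> and acts on \<open>V\<close> as the differential operator
  \<open>w X d/dX + b\<close> with a number \<open>w\<close> (the weight of \<open>r\<close>) and a polynomial \<open>b\<close> (the
  multiplier of \<open>r\<close>); see \<open>e1_bracket\<close> and \<open>\<phi>_bracket\<close>. Left multiplications carry
  almost no information: \<open>[r,V] = 0\<close> and \<open>[r,e\<^sub>1]\<close> is \<open>-w e\<^sub>1\<close> modulo \<open>V\<close>, because
  \<open>[r,s] + [s,r]\<close> always annihilates from the right while \<open>e\<^sub>1\<close> does not.

  The weight \<open>w\<close> and the constant term \<open>b(0)\<close> (the eigenvalue of \<open>r\<close>) are linear
  functionals that vanish on \<open>F\<close> and on all brackets. If an element \<open>k\<close> outside \<open>F\<close>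
  were killed by both, its right multiplication would raise the order of every polynomial,
  and a one-dimensional extension of \<open>F\<close> by such an element would be a
  pro-nilpotent ideal (\<open>pro_nilpotent_nil_extension\<close>), against maximality. That the
  extension can be chosen to be an ideal uses that all brackets of \<open>R\<close> lie in
  \<open>F + \<complex>z\<close> for some \<open>z\<close> outside \<open>F\<close>, i.e. that a two-dimensional Leibniz algebra is not perfect
  (\<open>brackets_mod_codim_2_ideal\<close>).

  Hence weight and eigenvalue are coordinates on the two-dimensional space \<open>R/F\<close>, and there are
  \<open>x\<close>, \<open>y\<close> with coordinates \<open>(1,0)\<close> and \<open>(0,1)\<close>. The commutator of the two differential
  operators must come from an element of \<open>F\<close>, so it is multiplication by a multiple of
  \<open>X\<close>; this forces the multiplier of \<open>y\<close> to be \<open>1 + cX\<close>, and \<open>y - c e\<^sub>1\<close> acts on \<open>V\<close> as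
  the identity. Subtracting \<open>[y,y]\<close> from \<open>y\<close> and \<open>[x,y]\<close> from \<open>x\<close> makes the Leibniz
  identity annihilate all other unwanted products (\<open>normalized_complement\<close>). What
  survives is the multiplier of \<open>x\<close>, whose coefficients are the parameters \<open>\<beta>\<close>.
\<close>

section \<open>Brackets and finite codimension\<close>

context complex_algebra
begin

lemma bracket_add_left: "\<lbrakk>a + b, c\<rbrakk> = \<lbrakk>a, c\<rbrakk> + \<lbrakk>b, c\<rbrakk>"
  and bracket_scale_left: "\<lbrakk>k *s a, c\<rbrakk> = k *s \<lbrakk>a, c\<rbrakk>"
  using bracket_linear_left[of c] by (simp_all add: Vector_Spaces.linear_iff)

lemma bracket_add_right: "\<lbrakk>a, b + c\<rbrakk> = \<lbrakk>a, b\<rbrakk> + \<lbrakk>a, c\<rbrakk>"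
  and bracket_scale_right: "\<lbrakk>a, k *s c\<rbrakk> = k *s \<lbrakk>a, c\<rbrakk>"
  using bracket_linear_right[of a] by (simp_all add: Vector_Spaces.linear_iff)

lemma bracket_zero_left: "\<lbrakk>0, a\<rbrakk> = 0"
  and bracket_zero_right: "\<lbrakk>a, 0\<rbrakk> = 0"
  using bracket_scale_left[of 0 0 a] bracket_scale_right[of a 0 0] by simp_all

lemma bracket_minus_left: "\<lbrakk>- a, b\<rbrakk> = - \<lbrakk>a, b\<rbrakk>"
  and bracket_minus_right: "\<lbrakk>a, - b\<rbrakk> = - \<lbrakk>a, b\<rbrakk>"
  using bracket_scale_left[of "-1" a b] bracket_scale_right[of a "-1" b] by simp_all

lemma bracket_diff_left: "\<lbrakk>a - b, c\<rbrakk> = \<lbrakk>a, c\<rbrakk> - \<lbrakk>b, c\<rbrakk>"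
  and bracket_diff_right: "\<lbrakk>a, b - c\<rbrakk> = \<lbrakk>a, b\<rbrakk> - \<lbrakk>a, c\<rbrakk>"
  using bracket_add_left[of a "- b" c] bracket_add_right[of a b "- c"]
  by (simp_all add: bracket_minus_left bracket_minus_right)

lemmas bracket_simps = bracket_add_left bracket_add_right bracket_scale_left bracket_scale_right
  bracket_zero_left bracket_zero_right bracket_minus_left bracket_minus_right
  bracket_diff_left bracket_diff_right

text \<open>A generating set of smallest cardinality modulo \<open>S\<close> is independent modulo \<open>S\<close>.\<close>
lemma finite_codim:
  assumes S: "subspace S" and fin: "finite B" and sub: "B \<subseteq> V" and gen: "span (S \<union> B) = V"
  shows "\<exists>n. has_codim S V n"
proof -
  define P where "P = (\<lambda>B. finite B \<and> B \<subseteq> V \<and> span (S \<union> B) = V)"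
  have "P B" using assms by (simp add: P_def)
  then obtain C where C: "P C" and min: "\<And>C'. P C' \<Longrightarrow> card C \<le> card C'"
    using ex_has_least_nat[of P B card] by blast
  have "\<forall>b\<in>C. c b = 0" if c: "(\<Sum>b\<in>C. c b *s b) \<in> S" for c
  proof (rule ccontr)
    assume "\<not> (\<forall>b\<in>C. c b = 0)"
    then obtain b where b: "b \<in> C" "c b \<noteq> 0" by blast
    let ?D = "C - {b}"
    have fC: "finite C" using C by (simp add: P_def)
    have sum: "(\<Sum>b\<in>C. c b *s b) = c b *s b + (\<Sum>d\<in>?D. c d *s d)"
      using fC b by (simp add: sum.remove)
    have 1: "(\<Sum>b\<in>C. c b *s b) \<in> span (S \<union> ?D)"
      using c by (simp add: span_base)
    have 2: "(\<Sum>d\<in>?D. c d *s d) \<in> span (S \<union> ?D)"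
      by (intro span_sum span_scale span_base) auto
    have "c b *s b \<in> span (S \<union> ?D)"
      using span_diff[OF 1 2] sum by simp
    then have "inverse (c b) *s (c b *s b) \<in> span (S \<union> ?D)" by (rule span_scale)
    then have bs: "b \<in> span (S \<union> ?D)" using b by simp
    have "S \<union> C = insert b (S \<union> ?D)" using b by auto
    then have "span (S \<union> ?D) = V"
      using span_redundant[OF bs] C by (simp add: P_def)
    then have "P ?D" using C by (auto simp: P_def)
    from min[OF this] b fC show False
      by (metis card_Diff1_less not_le)
  qed
  then have "has_codim S V (card C)"
    using C unfolding has_codim_def P_def by blast
  then show ?thesis ..
qed

lemma codim_2_coordinates:
  assumes N: "subspace N" and codim: "has_codim N UNIV 2"
  obtains u v where "\<And>r. \<exists>n\<in>N. \<exists>a b. r = n + a *s u + b *s v"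
    and "\<And>a b. a *s u + b *s v \<in> N \<Longrightarrow> a = 0 \<and> b = 0"
proof -
  obtain B where B: "card B = 2" "span (N \<union> B) = UNIV"
    and ind: "\<And>c. (\<Sum>b\<in>B. c b *s b) \<in> N \<Longrightarrow> \<forall>b\<in>B. c b = 0"
    using codim unfolding has_codim_def by blast
  then obtain u v where uv: "B = {u, v}" "u \<noteq> v"
    by (auto simp: card_2_iff)
  show ?thesis
  proof (rule that)
    fix r
    have "r \<in> span (insert u (insert v N))"
      using B uv by (simp add: insert_commute)
    then obtain a b where "r - a *s u - b *s v \<in> N"
      using span_eq_iff[THEN iffD2, OF N] by (auto simp: span_breakdown_eq)
    moreover have "r = (r - a *s u - b *s v) + a *s u + b *s v" by simp
    ultimately show "\<exists>n\<in>N. \<exists>a b. r = n + a *s u + b *s v" by blast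
  next
    fix a b assume "a *s u + b *s v \<in> N"
    then show "a = 0 \<and> b = 0"
      using ind[of "\<lambda>w. if w = u then a else b"] uv by auto
  qed
qed

text \<open>Steinitz exchange in the two-dimensional quotient by \<open>N\<close>, by Cramer's rule in the
  coordinates of some basis.\<close>
lemma codim_2_exchange:
  assumes N: "subspace N" and codim: "has_codim N UNIV 2"
    and ind: "\<And>a b. a *s x + b *s s \<in> N \<Longrightarrow> a = 0 \<and> b = 0"
  shows "\<exists>n\<in>N. \<exists>a b. r = n + a *s x + b *s s"
proof -
  obtain u v where dec: "\<And>r. \<exists>n\<in>N. \<exists>a b. r = n + a *s u + b *s v"
    using codim_2_coordinates[OF N codim] by metis
  obtain n1 a b where x: "n1 \<in> N" "x = n1 + a *s u + b *s v" using dec by blast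
  obtain n2 c d where s: "n2 \<in> N" "s = n2 + c *s u + d *s v" using dec by blast
  obtain n3 p q where r: "n3 \<in> N" "r = n3 + p *s u + q *s v" using dec by blast
  define D where "D = a * d - b * c"
  \<comment> \<open>If the determinant vanishes, its cofactors are the coefficients of a dependency
    between \<open>x\<close> and \<open>s\<close> modulo \<open>N\<close>.\<close>
  have "D \<noteq> 0"
  proof
    assume D: "D = 0"
    have "d *s x + (- b) *s s = d *s n1 - b *s n2 + D *s u"
      unfolding x s D_def by (simp add: algebra_simps)
    then have "d *s x + (- b) *s s \<in> N"
      using D x s N by (simp add: subspace_diff subspace_scale)
    then have db: "d = 0" "b = 0" using ind[of d "- b"] by auto
    have "c *s x + (- a) *s s = c *s n1 - a *s n2 - D *s v"
      unfolding x s D_def by (simp add: algebra_simps)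
    then have "c *s x + (- a) *s s \<in> N"
      using D x s N by (simp add: subspace_diff subspace_scale)
    then have "c = 0" "a = 0" using ind[of c "- a"] by auto
    then have "1 *s x + 0 *s s \<in> N" using x db by simp
    then show False using ind[of 1 0] by simp
  qed
  define k l where "k = (p * d - q * c) / D" and "l = (q * a - p * b) / D"
  have "k * a + l * c = p * D / D" "k * b + l * d = q * D / D"
    unfolding k_def l_def times_divide_eq_left add_divide_distrib[symmetric]
    by (simp_all add: D_def algebra_simps)
  then have kl: "k * a + l * c = p" "k * b + l * d = q"
    using \<open>D \<noteq> 0\<close> by simp_all
  have "k *s x + l *s s = k *s n1 + l *s n2 + (k * a + l * c) *s u + (k * b + l * d) *s v"
    unfolding x s by (simp add: algebra_simps)
  then have "r = (n3 - k *s n1 - l *s n2) + k *s x + l *s s"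
    unfolding kl r by (simp add: algebra_simps)
  moreover have "n3 - k *s n1 - l *s n2 \<in> N"
    using x s r N by (simp add: subspace_diff subspace_scale)
  ultimately show ?thesis by blast
qed

end

context leibniz_algebra
begin

lemma bracket_square: "\<lbrakk>a, \<lbrakk>b, b\<rbrakk>\<rbrakk> = 0"
  by (simp add: leibniz)

text \<open>Exchanging \<open>b\<close> and \<open>c\<close> changes the sign of the right-hand side of the Leibniz
  identity, so symmetrized products annihilate from the right.\<close>
lemma bracket_symmetric: "\<lbrakk>a, \<lbrakk>b, c\<rbrakk> + \<lbrakk>c, b\<rbrakk>\<rbrakk> = 0"
  by (simp add: leibniz bracket_add_right)

text \<open>The two-dimensional quotient by \<open>N\<close> is not perfect. If all its squares vanish, its bracket
  is alternating, and all brackets are multiples of a single one. Otherwise a nonzero square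
  \<open>s = [x,x]\<close> annihilates from the right, so that \<open>x\<close> and \<open>s\<close> form a basis, and
  \<open>[x,[s,x]] = 0\<close> shows that \<open>[s,x]\<close> is again a multiple of \<open>s\<close>.\<close>
lemma brackets_mod_codim_2_ideal:
  assumes N: "ideal N" and codim: "has_codim N UNIV 2"
  obtains z where "z \<notin> N" "\<And>r s. \<exists>n\<in>N. \<exists>c. \<lbrakk>r, s\<rbrakk> = n + c *s z"
proof -
  have sub: "subspace N" and right: "\<And>n r. n \<in> N \<Longrightarrow> \<lbrakk>n, r\<rbrakk> \<in> N"
    and left: "\<And>n r. n \<in> N \<Longrightarrow> \<lbrakk>r, n\<rbrakk> \<in> N"
    using N by (auto simp: ideal_def)
  note closed = subspace_add[OF sub] subspace_diff[OF sub] subspace_scale[OF sub] right left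
  show ?thesis
  proof (cases "\<forall>r. \<lbrakk>r, r\<rbrakk> \<in> N")
    case True
    obtain u v where dec: "\<And>r. \<exists>n\<in>N. \<exists>a b. r = n + a *s u + b *s v"
      and ind: "\<And>a b. a *s u + b *s v \<in> N \<Longrightarrow> a = 0 \<and> b = 0"
      using codim_2_coordinates[OF sub codim] by metis
    have "\<lbrakk>v, u\<rbrakk> + \<lbrakk>u, v\<rbrakk> = \<lbrakk>u + v, u + v\<rbrakk> - \<lbrakk>u, u\<rbrakk> - \<lbrakk>v, v\<rbrakk>"
      by (simp add: bracket_simps)
    then have anti: "\<lbrakk>v, u\<rbrakk> + \<lbrakk>u, v\<rbrakk> \<in> N" using True by (simp add: closed)
    have br: "\<exists>n\<in>N. \<exists>c. \<lbrakk>r, s\<rbrakk> = n + c *s \<lbrakk>u, v\<rbrakk>" for r s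
    proof -
      obtain m a b where r: "m \<in> N" "r = m + (a *s u + b *s v)"
        using dec[of r] by (auto simp: add.assoc)
      obtain n c d where s: "n \<in> N" "s = n + (c *s u + d *s v)"
        using dec[of s] by (auto simp: add.assoc)
      let ?n = "\<lbrakk>m, s\<rbrakk> + \<lbrakk>a *s u + b *s v, n\<rbrakk> + (a * c) *s \<lbrakk>u, u\<rbrakk> + (b * d) *s \<lbrakk>v, v\<rbrakk>
        + (b * c) *s (\<lbrakk>v, u\<rbrakk> + \<lbrakk>u, v\<rbrakk>)"
      have "\<lbrakk>r, s\<rbrakk> = ?n + (a * d - b * c) *s \<lbrakk>u, v\<rbrakk>"
        unfolding r s by (simp add: bracket_simps algebra_simps)
      moreover have "?n \<in> N"
        using r(1) s(1) True anti by (simp add: closed)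
      ultimately show ?thesis by blast
    qed
    show ?thesis
    proof (cases "\<lbrakk>u, v\<rbrakk> \<in> N")
      case False
      then show ?thesis using that br by blast
    next
      case uv: True
      have "\<lbrakk>r, s\<rbrakk> \<in> N" for r s using br[of r s] uv closed by auto
      then have "\<exists>n\<in>N. \<exists>c. \<lbrakk>r, s\<rbrakk> = n + c *s u" for r s
        by (metis add.right_neutral scale_zero_left)
      moreover have "u \<notin> N" using ind[of 1 0] by auto
      ultimately show ?thesis using that by blast
    qed
  next
    case False
    then obtain x where x: "\<lbrakk>x, x\<rbrakk> \<notin> N" by blast
    define s where "s = \<lbrakk>x, x\<rbrakk>"
    have sN: "s \<notin> N" using x s_def by simp
    have rs: "\<lbrakk>r, s\<rbrakk> = 0" for r unfolding s_def by (rule bracket_square)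
    have coeff0: "a = 0" if "a *s s \<in> N" for a
      using closed(3)[OF that, of "inverse a"] sN by (cases "a = 0") auto
    have ind: "a = 0 \<and> b = 0" if ab: "a *s x + b *s s \<in> N" for a b
    proof -
      have "\<lbrakk>x, a *s x + b *s s\<rbrakk> = a *s s" by (simp add: bracket_simps rs s_def[symmetric])
      then have "a = 0" using closed(5)[OF ab, of x] coeff0 by simp
      then show ?thesis using ab coeff0 by simp
    qed
    have dec: "\<exists>n\<in>N. \<exists>a b. r = n + a *s x + b *s s" for r
      using codim_2_exchange[OF sub codim ind] by blast
    obtain n a b where sx: "n \<in> N" "\<lbrakk>s, x\<rbrakk> = n + a *s x + b *s s" using dec by blast
    have "\<lbrakk>x, \<lbrakk>s, x\<rbrakk>\<rbrakk> = 0" using bracket_symmetric[of x s x] rs[of x] by simp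
    then have "a *s s = - \<lbrakk>x, n\<rbrakk>"
      unfolding sx by (simp add: bracket_simps rs s_def[symmetric] eq_neg_iff_add_eq_0 add.commute)
    then have "a = 0" using closed(5)[OF sx(1), of x] sub coeff0 by (simp add: subspace_neg)
    have "\<exists>n\<in>N. \<exists>c. \<lbrakk>r, q\<rbrakk> = n + c *s s" for r q
    proof -
      obtain m c d where r: "m \<in> N" "r = m + (c *s x + d *s s)"
        using dec[of r] by (auto simp: add.assoc)
      obtain l f g where q: "l \<in> N" "q = l + (f *s x + g *s s)"
        using dec[of q] by (auto simp: add.assoc)
      let ?n = "\<lbrakk>m, q\<rbrakk> + \<lbrakk>c *s x + d *s s, l\<rbrakk> + (d * f) *s n"
      have "\<lbrakk>r, q\<rbrakk> = ?n + (c * f + d * f * b) *s s"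
        unfolding r q using sx \<open>a = 0\<close>
        by (simp add: bracket_simps rs s_def[symmetric] algebra_simps)
      moreover have "?n \<in> N" using r(1) q(1) sx(1) by (simp add: closed)
      ultimately show ?thesis by blast
    qed
    then show ?thesis using that sN by blast
  qed
qed

end

section \<open>Right multiplications as differential operators\<close>

text \<open>An ideal that is a copy of \<open>F\<close>: the element \<open>e1\<close> is \<open>e\<^sub>1\<close>, and \<open>\<phi>\<close> sends
  \<open>X\<^sup>i\<close> to \<open>e\<^sub>i\<^sub>+\<^sub>2\<close>, so that \<open>pCons 0\<close> (multiplication by \<open>X\<close>) is right multiplication
  by \<open>e\<^sub>1\<close>.\<close>
locale F_ideal = leibniz_algebra scale bracket
  for scale :: "complex \<Rightarrow> 'a::ab_group_add \<Rightarrow> 'a" (infixr \<open>*s\<close> 75)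
    and bracket :: "'a \<Rightarrow> 'a \<Rightarrow> 'a" (\<open>\<lbrakk>_,/ _\<rbrakk>\<close>) +
  fixes N :: "'a set" and e1 :: 'a and \<phi> :: "complex poly \<Rightarrow> 'a"
  assumes ideal_N: "ideal N"
    and \<phi>_add: "\<phi> (p + q) = \<phi> p + \<phi> q"
    and \<phi>_smult: "\<phi> (smult c p) = c *s \<phi> p"
    and N_eq: "N = {c *s e1 + \<phi> p | c p. True}"
    and coords_zero: "c *s e1 + \<phi> p = 0 \<Longrightarrow> c = 0 \<and> p = 0"
    and e1_e1: "\<lbrakk>e1, e1\<rbrakk> = 0"
    and e1_\<phi>: "\<lbrakk>e1, \<phi> p\<rbrakk> = 0"
    and \<phi>_e1: "\<lbrakk>\<phi> p, e1\<rbrakk> = \<phi> (pCons 0 p)"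
    and \<phi>_\<phi>: "\<lbrakk>\<phi> p, \<phi> q\<rbrakk> = 0"
begin

lemma \<phi>_0: "\<phi> 0 = 0"
  using \<phi>_smult[of 0 0] by simp

lemma \<phi>_minus: "\<phi> (- p) = - \<phi> p"
  using \<phi>_smult[of "-1" p] by simp

lemma \<phi>_diff: "\<phi> (p - q) = \<phi> p - \<phi> q"
  using \<phi>_add[of p "- q"] by (simp add: \<phi>_minus)

lemma \<phi>_sum: "\<phi> (sum f A) = (\<Sum>i\<in>A. \<phi> (f i))"
  by (induction A rule: infinite_finite_induct) (simp_all add: \<phi>_0 \<phi>_add)

lemma \<phi>_eq_0: "\<phi> p = 0 \<Longrightarrow> p = 0"
  using coords_zero[of 0 p] by simp

lemma \<phi>_inj: "\<phi> p = \<phi> q \<longleftrightarrow> p = q"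
  using \<phi>_eq_0[of "p - q"] by (auto simp: \<phi>_diff)

lemma e1_nonzero: "e1 \<noteq> 0"
  using coords_zero[of 1 0] by (auto simp: \<phi>_0)

lemma \<phi>_pCons: "\<phi> (pCons c p) = c *s \<phi> 1 + \<phi> (pCons 0 p)"
  using \<phi>_add[of "smult c 1" "pCons 0 p"] \<phi>_smult[of c 1] by (simp add: one_pCons)

lemma subspace_N: "subspace N"
  and bracket_N_left: "n \<in> N \<Longrightarrow> \<lbrakk>n, r\<rbrakk> \<in> N"
  and bracket_N_right: "n \<in> N \<Longrightarrow> \<lbrakk>r, n\<rbrakk> \<in> N"
  using ideal_N by (auto simp: ideal_def)

lemma e1_in_N: "e1 \<in> N"
proof -
  have "e1 = 1 *s e1 + \<phi> 0" by (simp add: \<phi>_0)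
  then show ?thesis unfolding N_eq by blast
qed

lemma \<phi>_in_N: "\<phi> p \<in> N"
proof -
  have "\<phi> p = 0 *s e1 + \<phi> p" by simp
  then show ?thesis unfolding N_eq by blast
qed

lemma N_cases:
  assumes "n \<in> N"
  obtains c p where "n = c *s e1 + \<phi> p"
  using assms N_eq by auto

lemma N_\<phi>: "n \<in> N \<Longrightarrow> \<lbrakk>n, \<phi> p\<rbrakk> = 0"
  by (erule N_cases) (simp add: bracket_simps e1_\<phi> \<phi>_\<phi>)

text \<open>Coordinates of the derivation of \<open>F\<close> given by right multiplication by \<open>r\<close>. That the
  values described here exist is shown in \<open>e1_bracket\<close> and \<open>\<phi>_1_bracket\<close>.\<close>
definition weight :: "'a \<Rightarrow> complex"
  where "weight r = (THE a. \<lbrakk>e1, r\<rbrakk> = a *s e1)"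

definition multiplier :: "'a \<Rightarrow> complex poly"
  where "multiplier r = (THE b. \<lbrakk>\<phi> 1, r\<rbrakk> = \<phi> b)"

lemma weight_eqI: "\<lbrakk>e1, r\<rbrakk> = a *s e1 \<Longrightarrow> weight r = a"
  unfolding weight_def by (rule the_equality) (use e1_nonzero in simp_all)

lemma multiplier_eqI: "\<lbrakk>\<phi> 1, r\<rbrakk> = \<phi> b \<Longrightarrow> multiplier r = b"
  unfolding multiplier_def by (rule the_equality) (simp_all add: \<phi>_inj)

lemma derivation: "\<lbrakk>\<lbrakk>a, b\<rbrakk>, r\<rbrakk> = \<lbrakk>a, \<lbrakk>b, r\<rbrakk>\<rbrakk> + \<lbrakk>\<lbrakk>a, r\<rbrakk>, b\<rbrakk>"
  by (simp add: leibniz)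

text \<open>Differentiating \<open>[e\<^sub>1,e\<^sub>1] = 0\<close> leaves \<open>X q = 0\<close> for the \<open>V\<close>-component \<open>q\<close> of
  \<open>[e\<^sub>1,r]\<close>.\<close>
lemma e1_bracket: "\<lbrakk>e1, r\<rbrakk> = weight r *s e1"
proof -
  obtain a q where aq: "\<lbrakk>e1, r\<rbrakk> = a *s e1 + \<phi> q"
    using N_cases[OF bracket_N_left[OF e1_in_N]] by blast
  have "\<phi> (pCons 0 q) = 0"
    using derivation[of e1 e1 r] by (simp add: aq bracket_simps e1_e1 e1_\<phi> \<phi>_e1)
  then have "q = 0" using \<phi>_eq_0 by fastforce
  then have "\<lbrakk>e1, r\<rbrakk> = a *s e1" using aq by (simp add: \<phi>_0)
  then show ?thesis using weight_eqI by blast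
qed

text \<open>Differentiating \<open>[e\<^sub>2,e\<^sub>2] = 0\<close> leaves \<open>c e\<^sub>3 = 0\<close> for the \<open>e\<^sub>1\<close>-component \<open>c\<close> of
  \<open>[e\<^sub>2,r]\<close>.\<close>
lemma \<phi>_1_bracket: "\<lbrakk>\<phi> 1, r\<rbrakk> = \<phi> (multiplier r)"
proof -
  obtain c q where cq: "\<lbrakk>\<phi> 1, r\<rbrakk> = c *s e1 + \<phi> q"
    using N_cases[OF bracket_N_left[OF \<phi>_in_N]] by blast
  have "\<phi> (smult c (pCons 0 1)) = 0"
    using derivation[of "\<phi> 1" "\<phi> 1" r]
    by (simp only: \<phi>_smult) (simp add: cq bracket_simps e1_\<phi> \<phi>_e1 \<phi>_\<phi>)
  then have "c = 0" using \<phi>_eq_0 by fastforce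
  then have "\<lbrakk>\<phi> 1, r\<rbrakk> = \<phi> q" using cq by simp
  then show ?thesis using multiplier_eqI by simp
qed

text \<open>Since \<open>V\<close> is generated by \<open>e\<^sub>2\<close> under right multiplication by \<open>e\<^sub>1\<close>, the derivation
  property propagates the action from \<open>e\<^sub>1\<close> and \<open>e\<^sub>2\<close> to \<open>V\<close>. The result is the
  operator \<open>w X d/dX + b\<close>.\<close>
lemma \<phi>_bracket:
  "\<lbrakk>\<phi> p, r\<rbrakk> = \<phi> (smult (weight r) (pCons 0 (pderiv p)) + multiplier r * p)"
proof (induction p)
  case 0
  then show ?case by (simp add: \<phi>_0 bracket_simps)
next
  case (pCons c p)
  have "\<lbrakk>\<phi> (pCons 0 p), r\<rbrakk> = \<lbrakk>\<lbrakk>\<phi> p, e1\<rbrakk>, r\<rbrakk>" by (simp add: \<phi>_e1)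
  also have "\<dots> = weight r *s \<phi> (pCons 0 p)
      + \<phi> (pCons 0 (smult (weight r) (pCons 0 (pderiv p)) + multiplier r * p))"
    unfolding derivation[of "\<phi> p" e1 r] e1_bracket pCons.IH
    by (simp only: bracket_simps \<phi>_e1)
  finally have "\<lbrakk>\<phi> (pCons c p), r\<rbrakk> = c *s \<phi> (multiplier r) + (weight r *s \<phi> (pCons 0 p)
      + \<phi> (pCons 0 (smult (weight r) (pCons 0 (pderiv p)) + multiplier r * p)))"
    by (simp only: \<phi>_pCons[of c p] bracket_simps \<phi>_1_bracket)
  then show ?case
    by (simp add: \<phi>_smult[symmetric] \<phi>_add[symmetric] pderiv_pCons
        smult_add_right \<phi>_inj algebra_simps)
qed

lemma weight_add: "weight (r + s) = weight r + weight s"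
  by (rule weight_eqI) (simp add: bracket_simps e1_bracket scale_left_distrib)

lemma weight_diff: "weight (r - s) = weight r - weight s"
  by (rule weight_eqI) (simp add: bracket_simps e1_bracket scale_left_diff_distrib)

lemma weight_scale: "weight (c *s r) = c * weight r"
  by (rule weight_eqI) (simp add: bracket_simps e1_bracket)

lemma weight_bracket: "weight \<lbrakk>r, s\<rbrakk> = 0"
  by (rule weight_eqI) (simp add: leibniz bracket_simps e1_bracket mult.commute)

lemma weight_N: "n \<in> N \<Longrightarrow> weight n = 0"
  by (rule weight_eqI, erule N_cases) (simp add: bracket_simps e1_e1 e1_\<phi>)

lemma multiplier_add: "multiplier (r + s) = multiplier r + multiplier s"
  by (rule multiplier_eqI) (simp add: bracket_simps \<phi>_1_bracket \<phi>_add)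

lemma multiplier_diff: "multiplier (r - s) = multiplier r - multiplier s"
  by (rule multiplier_eqI) (simp add: bracket_simps \<phi>_1_bracket \<phi>_diff)

lemma multiplier_scale: "multiplier (c *s r) = smult c (multiplier r)"
  by (rule multiplier_eqI) (simp add: bracket_simps \<phi>_1_bracket \<phi>_smult)

text \<open>By the Leibniz identity, right multiplication by a bracket is a commutator of right
  multiplications, here of differential operators of order at most one.\<close>
lemma multiplier_bracket: "multiplier \<lbrakk>r, s\<rbrakk> =
    pCons 0 (smult (weight s) (pderiv (multiplier r)) - smult (weight r) (pderiv (multiplier s)))"
  by (rule multiplier_eqI)
    (simp add: leibniz \<phi>_1_bracket \<phi>_bracket \<phi>_diff[symmetric] \<phi>_inj algebra_simps)

lemma multiplier_N: "multiplier (c *s e1 + \<phi> p) = [:0, c:]"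
proof (rule multiplier_eqI)
  have "\<phi> [:0, c:] = \<phi> (smult c (pCons 0 1))" by (simp add: one_pCons)
  then show "\<lbrakk>\<phi> 1, c *s e1 + \<phi> p\<rbrakk> = \<phi> [:0, c:]"
    by (simp add: \<phi>_smult bracket_simps \<phi>_\<phi> \<phi>_e1 del: smult_pCons)
qed

lemma multiplier_e1: "multiplier e1 = [:0, 1:]"
  and multiplier_\<phi>: "multiplier (\<phi> p) = 0"
  using multiplier_N[of 1 0] multiplier_N[of 0 p] by (simp_all add: \<phi>_0)

text \<open>The diagonal entry of the (triangular) action of \<open>r\<close> at \<open>e\<^sub>2\<close>.\<close>
definition eigenvalue :: "'a \<Rightarrow> complex"
  where "eigenvalue r = coeff (multiplier r) 0"

lemma eigenvalue_add: "eigenvalue (r + s) = eigenvalue r + eigenvalue s"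
  and eigenvalue_diff: "eigenvalue (r - s) = eigenvalue r - eigenvalue s"
  and eigenvalue_scale: "eigenvalue (c *s r) = c * eigenvalue r"
  and eigenvalue_bracket: "eigenvalue \<lbrakk>r, s\<rbrakk> = 0"
  by (simp_all add: eigenvalue_def multiplier_add multiplier_diff multiplier_scale multiplier_bracket)

lemma eigenvalue_N: "n \<in> N \<Longrightarrow> eigenvalue n = 0"
  by (erule N_cases) (simp add: eigenvalue_def multiplier_N)

lemma in_\<phi>_if_multiplier_0:
  assumes "n \<in> N" "multiplier n = 0"
  obtains p where "n = \<phi> p"
proof -
  obtain c p where n: "n = c *s e1 + \<phi> p" using assms(1) by (rule N_cases)
  then have "c = 0" using assms(2) by (simp add: multiplier_N)
  then show ?thesis using that n by simp
qed

lemma multiplier_symmetric: "multiplier (\<lbrakk>r, s\<rbrakk> + \<lbrakk>s, r\<rbrakk>) = 0"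
  by (rule multiplier_eqI) (simp add: bracket_symmetric \<phi>_0)

text \<open>The Leibniz identity for \<open>[r,[e\<^sub>1,e\<^sub>2]] = 0\<close> removes the \<open>V\<close>-component of \<open>[r,e\<^sub>2]\<close>.
  Its \<open>e\<^sub>1\<close>-component is that of \<open>[r,e\<^sub>2] + [e\<^sub>2,r]\<close>, which annihilates from the right and
  hence has none. The generation of \<open>V\<close> from \<open>e\<^sub>2\<close> does the rest.\<close>
lemma bracket_\<phi>: "\<lbrakk>r, \<phi> p\<rbrakk> = 0"
proof -
  obtain c q where cq: "\<lbrakk>r, \<phi> 1\<rbrakk> = c *s e1 + \<phi> q"
    using N_cases[OF bracket_N_right[OF \<phi>_in_N]] by blast
  have "\<phi> (pCons 0 q) = 0"
    using leibniz[of r e1 "\<phi> 1"]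
    by (simp add: e1_\<phi> bracket_zero_right N_\<phi>[OF bracket_N_right[OF e1_in_N]])
       (simp add: cq bracket_simps e1_e1 \<phi>_e1)
  then have q: "q = 0" using \<phi>_eq_0 by fastforce
  have "multiplier (c *s e1 + \<phi> (multiplier r)) = 0"
    using multiplier_symmetric[of r "\<phi> 1"] q by (simp add: cq \<phi>_0 \<phi>_1_bracket)
  then have "c = 0" by (simp add: multiplier_N)
  then have 1: "\<lbrakk>r, \<phi> 1\<rbrakk> = 0" using cq q by (simp add: \<phi>_0)
  show ?thesis
  proof (induction p)
    case 0
    then show ?case by (simp add: \<phi>_0 bracket_simps)
  next
    case (pCons c p)
    have "\<lbrakk>r, \<phi> (pCons 0 p)\<rbrakk> = 0"
      unfolding \<phi>_e1[symmetric] leibniz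
      by (simp add: pCons.IH bracket_simps N_\<phi>[OF bracket_N_right[OF e1_in_N]])
    then show ?case by (simp add: \<phi>_pCons[of c p] bracket_simps 1)
  qed
qed

lemma bracket_e1:
  obtains g where "\<lbrakk>r, e1\<rbrakk> = - (weight r *s e1) + \<phi> g"
proof -
  have "\<lbrakk>r, e1\<rbrakk> + \<lbrakk>e1, r\<rbrakk> \<in> N"
    by (intro subspace_add[OF subspace_N] bracket_N_left bracket_N_right e1_in_N)
  then obtain g where "\<lbrakk>r, e1\<rbrakk> + \<lbrakk>e1, r\<rbrakk> = \<phi> g"
    using in_\<phi>_if_multiplier_0[OF _ multiplier_symmetric] by blast
  then have "\<lbrakk>r, e1\<rbrakk> = - (weight r *s e1) + \<phi> g"
    by (simp add: e1_bracket algebra_simps)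
  then show ?thesis by (rule that)
qed

section \<open>Maximality and nil elements\<close>

text \<open>The span of the \<open>e\<^sub>i\<close> with \<open>i \<ge> k + 2\<close>, i.e. the polynomials divisible by
  \<open>X\<^sup>k\<close>.\<close>
definition tail :: "nat \<Rightarrow> 'a set"
  where "tail k = {\<phi> p | p. \<forall>i<k. coeff p i = 0}"

lemma tail_0: "\<phi> p \<in> tail 0"
  by (auto simp: tail_def)

lemma subspace_tail: "subspace (tail k)"
proof (rule subspaceI)
  have "0 = \<phi> 0" by (simp add: \<phi>_0)
  then show "0 \<in> tail k" unfolding tail_def by fastforce
next
  fix a b assume "a \<in> tail k" "b \<in> tail k"
  then obtain p q where "a = \<phi> p" "b = \<phi> q" "\<forall>i<k. coeff p i = 0" "\<forall>i<k. coeff q i = 0"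
    by (auto simp: tail_def)
  then have "a + b = \<phi> (p + q)" "\<forall>i<k. coeff (p + q) i = 0"
    by (simp_all add: \<phi>_add)
  then show "a + b \<in> tail k" unfolding tail_def by blast
next
  fix c a assume "a \<in> tail k"
  then obtain p where "a = \<phi> p" "\<forall>i<k. coeff p i = 0"
    by (auto simp: tail_def)
  then have "c *s a = \<phi> (smult c p)" "\<forall>i<k. coeff (smult c p) i = 0"
    by (simp_all add: \<phi>_smult)
  then show "c *s a \<in> tail k" unfolding tail_def by blast
qed

lemma tail_Suc:
  assumes "a \<in> tail (Suc k)"
  obtains b where "b \<in> tail k" "a = \<lbrakk>b, e1\<rbrakk>"
proof -
  obtain p where p: "a = \<phi> p" "\<forall>i<Suc k. coeff p i = 0"
    using assms by (auto simp: tail_def)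
  obtain c q where pq: "p = pCons c q" by (cases p)
  have "c = 0" using p(2) pq by (metis coeff_pCons_0 zero_less_Suc)
  have "\<forall>i<k. coeff q i = 0" using p(2) pq by (metis Suc_mono coeff_pCons_Suc)
  then have "\<phi> q \<in> tail k" unfolding tail_def by blast
  moreover have "a = \<lbrakk>\<phi> q, e1\<rbrakk>" using p pq \<open>c = 0\<close> by (simp add: \<phi>_e1)
  ultimately show ?thesis by (rule that)
qed

lemma Inter_tail: "(\<Inter>k. tail k) = {0}"
proof -
  have "a = 0" if a: "\<And>k. a \<in> tail k" for a
  proof -
    obtain p where p: "a = \<phi> p" using a[of 0] by (auto simp: tail_def)
    have "coeff p i = 0" for i
      using a[of "Suc i"] p by (auto simp: tail_def \<phi>_inj)
    then have "p = 0" by (simp add: poly_eqI)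
    then show ?thesis using p by (simp add: \<phi>_0)
  qed
  moreover have "0 \<in> tail k" for k by (rule subspace_0[OF subspace_tail])
  ultimately show ?thesis by auto
qed

lemma \<phi>_mod_tail: "\<phi> p \<in> span (tail k \<union> (\<lambda>i. \<phi> (monom 1 i)) ` {..<k})"
proof -
  let ?q = "\<Sum>i<k. monom (coeff p i) i"
  have c: "coeff ?q i = coeff p i" if "i < k" for i
    using that by (simp add: coeff_sum)
  have "\<phi> (p - ?q) \<in> tail k" unfolding tail_def using c by auto
  moreover have "\<phi> ?q = (\<Sum>i<k. coeff p i *s \<phi> (monom 1 i))"
    unfolding \<phi>_sum by (simp add: \<phi>_smult[symmetric] smult_monom)
  moreover have "\<phi> p = \<phi> (p - ?q) + \<phi> ?q" by (simp add: \<phi>_diff)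
  ultimately show ?thesis
    by (auto intro!: span_add span_sum span_scale intro: span_base)
qed

text \<open>Both \<open>e\<^sub>1\<close> and \<open>z\<close> act on \<open>V\<close> as multiplications by multiples of \<open>X\<close>, so each
  further bracket with \<open>J\<close> raises the order of a polynomial by at least one, and repeated
  brackets with \<open>e\<^sub>1\<close> raise it by exactly one. The lower central series is thus squeezed
  between the tails of \<open>V\<close>, with a shift by one index.\<close>
lemma pro_nilpotent_nil_extension:
  assumes z: "z \<notin> N" "weight z = 0" "eigenvalue z = 0"
    and J: "J = {n + c *s z | n c. n \<in> N}" "ideal J"
  shows "pro_nilpotent J"
proof -
  have sub_J: "subspace J" and J_left: "\<And>a r. a \<in> J \<Longrightarrow> \<lbrakk>a, r\<rbrakk> \<in> J"
    using J(2) by (auto simp: ideal_def)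
  have "z = 0 + 1 *s z" by simp
  then have zJ: "z \<in> J" unfolding J(1) using subspace_0[OF subspace_N] by blast
  have NJ: "N \<subseteq> J" unfolding J(1) by force
  obtain b where b: "multiplier z = pCons 0 b"
    using z(3) by (metis eigenvalue_def coeff_pCons_0 pCons_cases)
  have \<phi>z: "\<lbrakk>\<phi> p, z\<rbrakk> = \<phi> (pCons 0 (b * p))" for p
    by (simp add: \<phi>_bracket z b)
  have e1z: "\<lbrakk>e1, z\<rbrakk> = 0" by (simp add: e1_bracket z)
  obtain g where ze1: "\<lbrakk>z, e1\<rbrakk> = \<phi> g" using bracket_e1[of z] by (auto simp: z)
  \<comment> \<open>A one-dimensional Leibniz algebra is abelian: if \<open>[z,z]\<close> is \<open>c z\<close> modulo
    \<open>N\<close>, then \<open>[z,[z,z]] = 0\<close> gives \<open>c\<^sup>2 = 0\<close>.\<close>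
  have "\<lbrakk>z, z\<rbrakk> \<in> N"
  proof -
    obtain n c where nc: "n \<in> N" "\<lbrakk>z, z\<rbrakk> = n + c *s z"
      using J_left[OF zJ, of z] unfolding J(1) by blast
    have "\<lbrakk>z, \<lbrakk>z, z\<rbrakk>\<rbrakk> = \<lbrakk>z, n\<rbrakk> + c *s n + (c * c) *s z"
      unfolding nc(2) by (simp add: bracket_simps nc(2) algebra_simps)
    then have "(c * c) *s z + (\<lbrakk>z, n\<rbrakk> + c *s n) = 0"
      by (simp add: bracket_square add.commute)
    then have "(c * c) *s z = - (\<lbrakk>z, n\<rbrakk> + c *s n)"
      by (rule eq_neg_iff_add_eq_0[THEN iffD2])
    then have "(c * c) *s z \<in> N"
      using nc(1) subspace_N by (simp add: subspace_neg subspace_add subspace_scale bracket_N_right del: minus_add_distrib)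
    then have "inverse (c * c) *s ((c * c) *s z) \<in> N"
      by (rule subspace_scale[OF subspace_N])
    then have "(inverse (c * c) * (c * c)) *s z \<in> N" by (simp only: scale_scale)
    moreover have "inverse (c * c) * (c * c) = 1" if "c \<noteq> 0"
      by (rule left_inverse) (use that in simp)
    ultimately have "c = 0" using z(1) by (metis scale_one)
    then show ?thesis using nc by simp
  qed
  then obtain s where zz: "\<lbrakk>z, z\<rbrakk> = \<phi> s"
    using in_\<phi>_if_multiplier_0 multiplier_eqI[of "\<lbrakk>z, z\<rbrakk>" 0] bracket_square[of "\<phi> 1" z]
    by (metis \<phi>_0)
  have J_cases: "\<exists>c d p. a = c *s e1 + \<phi> p + d *s z" if "a \<in> J" for a
    using that unfolding J(1) N_eq by blast
  have step_0: "\<lbrakk>a, r\<rbrakk> \<in> tail 0" if ar: "a \<in> J" "r \<in> J" for a r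
  proof -
    obtain c d p where a: "a = c *s e1 + \<phi> p + d *s z" using J_cases[OF ar(1)] by blast
    obtain f h q where r: "r = f *s e1 + \<phi> q + h *s z" using J_cases[OF ar(2)] by blast
    have "\<lbrakk>a, r\<rbrakk> = f *s \<phi> (pCons 0 p) + (f * d) *s \<phi> g + h *s \<phi> (pCons 0 (b * p)) + (h * d) *s \<phi> s"
      unfolding a r
      by (simp add: bracket_simps e1_e1 e1_\<phi> \<phi>_\<phi> \<phi>_e1 bracket_\<phi> \<phi>z e1z ze1 zz algebra_simps)
    then show ?thesis by (simp add: \<phi>_add[symmetric] \<phi>_smult[symmetric] tail_0)
  qed
  have step: "\<lbrakk>a, r\<rbrakk> \<in> tail (Suc k)" if ar: "a \<in> tail k" "r \<in> J" for a r k
  proof -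
    obtain p where a: "a = \<phi> p" and p: "\<forall>i<k. coeff p i = 0"
      using ar(1) unfolding tail_def by blast
    obtain f h q where r: "r = f *s e1 + \<phi> q + h *s z" using J_cases[OF ar(2)] by blast
    let ?p = "smult f (pCons 0 p) + smult h (pCons 0 (b * p))"
    have "\<lbrakk>a, r\<rbrakk> = \<phi> ?p"
      unfolding a r by (simp only: bracket_simps \<phi>_\<phi> \<phi>_e1 \<phi>z \<phi>_add \<phi>_smult add_0_right)
    moreover have "coeff ?p i = 0" if "i < Suc k" for i
      using p that by (cases i) (auto simp: coeff_mult)
    ultimately show ?thesis unfolding tail_def by blast
  qed
  have upper: "lower_central J (Suc k) \<subseteq> tail k" for k
  proof (induction k)
    case 0
    have "lower_central J (Suc 0) = bracket_span J J" by simp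
    also have "\<dots> \<subseteq> tail 0"
      unfolding bracket_span_def using step_0 by (intro span_minimal subspace_tail) blast
    finally show ?case .
  next
    case (Suc k)
    have "lower_central J (Suc (Suc k)) = bracket_span (lower_central J (Suc k)) J" by simp
    also have "\<dots> \<subseteq> tail (Suc k)"
      unfolding bracket_span_def using Suc.IH step by (intro span_minimal subspace_tail) blast
    finally show ?case .
  qed
  have lower: "tail k \<subseteq> lower_central J k" for k
  proof (induction k)
    case 0
    show ?case using NJ \<phi>_in_N by (auto simp: tail_def)
  next
    case (Suc k)
    show ?case
    proof
      fix a assume "a \<in> tail (Suc k)"
      then obtain b where "b \<in> tail k" "a = \<lbrakk>b, e1\<rbrakk>" by (rule tail_Suc)
      then show "a \<in> lower_central J (Suc k)"
        using Suc.IH NJ e1_in_N by (auto simp: bracket_span_def intro!: span_base)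
    qed
  qed
  have LC: "subspace (lower_central J k) \<and> lower_central J k \<subseteq> J" for k
  proof (induction k)
    case 0
    show ?case using sub_J by simp
  next
    case (Suc k)
    then show ?case
      unfolding lower_central.simps bracket_span_def
      using J_left by (intro conjI subspace_span span_minimal sub_J) blast
  qed
  have "(\<Inter>k. lower_central J k) = {0}"
  proof -
    have "(\<Inter>k. lower_central J k) \<subseteq> (\<Inter>k. tail k)" using upper by blast
    moreover have "0 \<in> lower_central J k" for k using LC subspace_0 by blast
    ultimately show ?thesis unfolding Inter_tail by blast
  qed
  moreover have "\<exists>n. has_codim (lower_central J k) J n" for k
  proof (rule finite_codim)
    let ?B = "{z, e1} \<union> (\<lambda>i. \<phi> (monom 1 i)) ` {..<k}"
    show "subspace (lower_central J k)" "finite ?B" "?B \<subseteq> J"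
      using LC zJ NJ e1_in_N \<phi>_in_N by auto
    show "span (lower_central J k \<union> ?B) = J"
    proof
      show "span (lower_central J k \<union> ?B) \<subseteq> J"
        using LC zJ NJ e1_in_N \<phi>_in_N by (intro span_minimal sub_J) auto
      have 1: "\<phi> p \<in> span (lower_central J k \<union> ?B)" for p
        by (rule subsetD[OF span_mono \<phi>_mod_tail[of p k]]) (use lower[of k] in auto)
      show "J \<subseteq> span (lower_central J k \<union> ?B)"
      proof
        fix a assume "a \<in> J"
        then obtain c d p where "a = c *s e1 + \<phi> p + d *s z" using J_cases by blast
        then show "a \<in> span (lower_central J k \<union> ?B)"
          using 1 by (auto intro!: span_add span_scale intro: span_base)
      qed
    qed
  qed
  ultimately show ?thesis by (simp add: pro_nilpotent_def)
qed

text \<open>All brackets lie in \<open>N + \<complex>z\<close> for a suitable \<open>z\<close> outside \<open>N\<close>. If \<open>z\<close> itself is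
  nil, \<open>N + \<complex>z\<close> is an ideal that contradicts maximality. If it is not, then all brackets
  lie in \<open>N\<close>, as weight and eigenvalue vanish on brackets, and any nil \<open>k\<close>
  outside \<open>N\<close> can take the place of \<open>z\<close>.\<close>
lemma nil_elements_in_N:
  assumes codim: "has_codim N UNIV 2"
    and maximal: "\<And>J. ideal J \<Longrightarrow> pro_nilpotent J \<Longrightarrow> N \<subseteq> J \<Longrightarrow> J = N"
    and k: "weight k = 0" "eigenvalue k = 0"
  shows "k \<in> N"
proof (rule ccontr)
  assume kN: "k \<notin> N"
  obtain z where z: "z \<notin> N" "\<And>r s. \<exists>n\<in>N. \<exists>c. \<lbrakk>r, s\<rbrakk> = n + c *s z"
    using brackets_mod_codim_2_ideal[OF ideal_N codim] by blast
  obtain w where w: "w \<notin> N" "weight w = 0" "eigenvalue w = 0"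
    "\<And>r s. \<exists>n\<in>N. \<exists>c. \<lbrakk>r, s\<rbrakk> = n + c *s w"
  proof (cases "weight z = 0 \<and> eigenvalue z = 0")
    case True
    then show ?thesis using that z by blast
  next
    case False
    have "\<exists>n\<in>N. \<exists>c. \<lbrakk>r, s\<rbrakk> = n + c *s k" for r s
    proof -
      obtain n c where nc: "n \<in> N" "\<lbrakk>r, s\<rbrakk> = n + c *s z" using z(2) by blast
      have "c * weight z = 0" "c * eigenvalue z = 0"
        using weight_bracket[of r s] eigenvalue_bracket[of r s] nc
        by (simp_all add: weight_add weight_scale weight_N eigenvalue_add eigenvalue_scale eigenvalue_N)
      then have "\<lbrakk>r, s\<rbrakk> = n + 0 *s k" using False nc by auto
      then show ?thesis using nc by blast
    qed
    then show ?thesis using that kN k by blast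
  qed
  define J where "J = {n + c *s w | n c. n \<in> N}"
  have "subspace J"
  proof (rule subspaceI)
    show "0 \<in> J" unfolding J_def using subspace_0[OF subspace_N] by force
  next
    fix a b assume "a \<in> J" "b \<in> J"
    then obtain m n c d where "m \<in> N" "n \<in> N" "a = m + c *s w" "b = n + d *s w"
      unfolding J_def by blast
    then have "a + b = (m + n) + (c + d) *s w" "m + n \<in> N"
      by (simp_all add: algebra_simps subspace_add[OF subspace_N])
    then show "a + b \<in> J" unfolding J_def by blast
  next
    fix c a assume "a \<in> J"
    then obtain n d where "n \<in> N" "a = n + d *s w" unfolding J_def by blast
    then have "c *s a = c *s n + (c * d) *s w" "c *s n \<in> N"
      by (simp_all add: algebra_simps subspace_scale[OF subspace_N])
    then show "c *s a \<in> J" unfolding J_def by blast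
  qed
  moreover have "\<lbrakk>r, s\<rbrakk> \<in> J" for r s using w(4) unfolding J_def by blast
  ultimately have "ideal J" by (simp add: ideal_def)
  moreover have "pro_nilpotent J"
    by (rule pro_nilpotent_nil_extension[OF w(1-3) J_def \<open>ideal J\<close>])
  moreover have "N \<subseteq> J" unfolding J_def by force
  ultimately have "J = N" by (rule maximal)
  moreover have "w = 0 + 1 *s w" by simp
  then have "w \<in> J" unfolding J_def using subspace_0[OF subspace_N] by blast
  ultimately show False using w(1) by simp
qed

section \<open>Normalization of the complement\<close>

text \<open>Two functionals on a two-dimensional quotient with no common kernel are coordinates:
  the matrix of their values on a basis is invertible, and \<open>x\<close>, \<open>y\<close> are read off from its
  inverse.\<close>
lemma dual_elements:
  assumes codim: "has_codim N UNIV 2"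
    and nil: "\<And>r. weight r = 0 \<Longrightarrow> eigenvalue r = 0 \<Longrightarrow> r \<in> N"
  obtains x y where "weight x = 1" "eigenvalue x = 0" "weight y = 0" "eigenvalue y = 1"
proof -
  obtain u v where ind: "\<And>a b. a *s u + b *s v \<in> N \<Longrightarrow> a = 0 \<and> b = 0"
    using codim_2_coordinates[OF subspace_N codim] by metis
  note lin = weight_add weight_scale eigenvalue_add eigenvalue_scale
  define D where "D = weight u * eigenvalue v - weight v * eigenvalue u"
  have "D \<noteq> 0"
  proof
    assume "D = 0"
    have "eigenvalue v *s u + (- eigenvalue u) *s v \<in> N"
      using \<open>D = 0\<close> by (intro nil; unfold lin) (simp_all add: D_def algebra_simps)
    moreover have "weight v *s u + (- weight u) *s v \<in> N"
      using \<open>D = 0\<close> by (intro nil; unfold lin) (simp_all add: D_def algebra_simps)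
    ultimately have "eigenvalue u = 0" "weight u = 0"
      using ind by fastforce+
    then have "1 *s u + 0 *s v \<in> N" by (intro nil) (simp_all add: lin)
    then show False using ind by fastforce
  qed
  show ?thesis
  proof (rule that)
    let ?x = "inverse D *s (eigenvalue v *s u + (- eigenvalue u) *s v)"
    let ?y = "inverse D *s ((- weight v) *s u + weight u *s v)"
    have "weight ?x = inverse D * D" "eigenvalue ?y = inverse D * D"
      unfolding lin by (simp_all add: D_def algebra_simps)
    then show "weight ?x = 1" "eigenvalue ?y = 1" using \<open>D \<noteq> 0\<close> by simp_all
    show "eigenvalue ?x = 0" "weight ?y = 0"
      unfolding lin by simp_all
  qed
qed

text \<open>Elements of \<open>V\<close> act trivially from the right, so \<open>x\<close> and \<open>y\<close> may be changed by
  them without affecting their action. Once \<open>y\<close> acts on \<open>V\<close> as the identity, the product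
  \<open>v = [x,y]\<close> is removed by passing to \<open>x - v\<close>, as \<open>[v,y] = v\<close>, and similarly for \<open>[y,y]\<close>.
  For each of the remaining unwanted products, of the form \<open>[a,c]\<close> or its \<open>V\<close>-part, the Leibniz
  identity for \<open>[a,[c,y]]\<close> says that \<open>y\<close> annihilates it; but it lies in \<open>V\<close>, where \<open>y\<close>
  acts as the identity, so it is zero.\<close>
lemma normalized_complement:
  assumes codim: "has_codim N UNIV 2"
    and nil: "\<And>r. weight r = 0 \<Longrightarrow> eigenvalue r = 0 \<Longrightarrow> r \<in> N"
  obtains x y where "weight x = 1" "eigenvalue x = 0" "weight y = 0" "multiplier y = 1"
    "\<lbrakk>x, e1\<rbrakk> = - e1" "\<lbrakk>y, e1\<rbrakk> = 0" "\<lbrakk>x, x\<rbrakk> = 0" "\<lbrakk>x, y\<rbrakk> = 0" "\<lbrakk>y, x\<rbrakk> = 0" "\<lbrakk>y, y\<rbrakk> = 0"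
proof -
  obtain x0 y0 where x0: "weight x0 = 1" "eigenvalue x0 = 0"
    and y0: "weight y0 = 0" "eigenvalue y0 = 1"
    using dual_elements[OF codim nil] by blast
  have bracket_in_N: "\<lbrakk>r, s\<rbrakk> \<in> N" for r s
    by (rule nil) (simp_all add: weight_bracket eigenvalue_bracket)
  have square: "\<exists>p. \<lbrakk>r, r\<rbrakk> = \<phi> p" for r
    using in_\<phi>_if_multiplier_0[OF bracket_in_N[of r r]] multiplier_eqI[of "\<lbrakk>r, r\<rbrakk>" 0]
      bracket_square[of "\<phi> 1" r] by (metis \<phi>_0)
  obtain b where b: "multiplier y0 = 1 + [:0, b:]"
  proof -
    obtain c p where cp: "\<lbrakk>x0, y0\<rbrakk> = c *s e1 + \<phi> p" using bracket_in_N by (rule N_cases)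
    \<comment> \<open>Both sides are the multiplier of \<open>[x0,y0]\<close>: as a commutator of operators, and
      as an element of \<open>N\<close>.\<close>
    have "pCons 0 (- pderiv (multiplier y0)) = [:0, c:]"
      using multiplier_bracket[of x0 y0] x0 y0 by (simp add: cp multiplier_N)
    then have "- pderiv (multiplier y0) = [:c:]" by (simp only: pCons_eq_iff)
    then have "pderiv (multiplier y0) + [:c:] = 0" by (metis add.right_inverse)
    then have "pderiv (multiplier y0 + [:0, c:] - 1) = 0"
      by (simp add: pderiv_add pderiv_diff pderiv_pCons)
    then obtain d where d: "multiplier y0 + [:0, c:] - 1 = [:d:]"
      using pderiv_iszero by blast
    have "coeff (multiplier y0 + [:0, c:] - 1) 0 = 0" using y0 by (simp add: eigenvalue_def)
    then have "multiplier y0 + [:0, c:] - 1 = 0" unfolding d by simp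
    then have "multiplier y0 = 1 - [:0, c:]"
      by (metis add_diff_cancel_right' eq_iff_diff_eq_0)
    then have "multiplier y0 = 1 + [:0, - c:]" by simp
    then show ?thesis by (rule that)
  qed
  define y1 where "y1 = y0 - b *s e1"
  have y1: "weight y1 = 0" "multiplier y1 = 1"
    by (simp_all add: y1_def weight_diff weight_scale weight_N[OF e1_in_N] y0
        multiplier_diff multiplier_scale multiplier_e1 b)
  obtain q where q: "\<lbrakk>y1, y1\<rbrakk> = \<phi> q" using square by blast
  define y where "y = y1 - \<phi> q"
  have y: "weight y = 0" "multiplier y = 1"
    by (simp_all add: y_def weight_diff weight_N[OF \<phi>_in_N] multiplier_diff multiplier_\<phi> y1)
  have \<phi>_y: "\<lbrakk>\<phi> p, y\<rbrakk> = \<phi> p" for p by (simp add: \<phi>_bracket y)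
  have e1_y: "\<lbrakk>e1, y\<rbrakk> = 0" by (simp add: e1_bracket y)
  have yy: "\<lbrakk>y, y\<rbrakk> = 0"
    using \<phi>_y[of q] by (simp add: y_def bracket_simps q bracket_\<phi> \<phi>_\<phi>)
  obtain g where g: "\<lbrakk>y, e1\<rbrakk> = \<phi> g" using bracket_e1[of y] by (auto simp: y)
  have ye1: "\<lbrakk>y, e1\<rbrakk> = 0"
    using leibniz[of y e1 y] by (simp add: e1_y yy bracket_simps g \<phi>_y)
  obtain v where v: "\<lbrakk>x0, y\<rbrakk> = \<phi> v"
    by (rule in_\<phi>_if_multiplier_0[OF bracket_in_N[of x0 y]])
       (simp add: multiplier_bracket y)
  define x where "x = x0 - \<phi> v"
  have x: "weight x = 1" "eigenvalue x = 0"
    by (simp_all add: x_def weight_diff weight_N[OF \<phi>_in_N] eigenvalue_diff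
        eigenvalue_N[OF \<phi>_in_N] x0)
  have xy: "\<lbrakk>x, y\<rbrakk> = 0" by (simp add: x_def bracket_simps v \<phi>_y)
  obtain w where w: "\<lbrakk>y, x\<rbrakk> = \<phi> w"
    using in_\<phi>_if_multiplier_0[OF bracket_in_N, of y x] multiplier_symmetric[of y x]
    by (auto simp: xy)
  have yx: "\<lbrakk>y, x\<rbrakk> = 0"
    using leibniz[of y x y] by (simp add: xy yy bracket_simps w \<phi>_y)
  obtain s where s: "\<lbrakk>x, x\<rbrakk> = \<phi> s" using square by blast
  have xx: "\<lbrakk>x, x\<rbrakk> = 0"
    using leibniz[of x x y] by (simp add: xy bracket_simps s \<phi>_y)
  obtain h where h: "\<lbrakk>x, e1\<rbrakk> = - e1 + \<phi> h" using bracket_e1[of x] by (auto simp: x)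
  have "\<phi> h = 0"
    using leibniz[of x e1 y] by (simp add: xy e1_y bracket_simps h \<phi>_y)
  then have xe1: "\<lbrakk>x, e1\<rbrakk> = - e1" using h by simp
  show ?thesis using that x y xe1 ye1 xx xy yx yy by blast
qed

end

section \<open>Polynomial coordinates from a basis\<close>

context complex_algebra
begin

definition combination :: "(nat \<Rightarrow> 'a) \<Rightarrow> complex poly \<Rightarrow> 'a"
  where "combination e p = (\<Sum>i\<le>degree p. coeff p i *s e (i + 2))"

text \<open>Any bound on the degree may serve as the upper limit of the sum, so polynomials of
  different degrees can be compared termwise.\<close>
lemma combination_eq:
  assumes "degree p \<le> n"
  shows "combination e p = (\<Sum>i\<le>n. coeff p i *s e (i + 2))"
  unfolding combination_def using assms
  by (intro sum.mono_neutral_left) (auto simp: coeff_eq_0 not_le)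

lemma combination_add: "combination e (p + q) = combination e p + combination e q"
proof -
  let ?n = "max (degree p) (degree q)"
  have "degree (p + q) \<le> ?n" by (rule degree_add_le_max)
  then show ?thesis
    by (simp add: combination_eq[of _ ?n] scale_left_distrib sum.distrib)
qed

lemma combination_smult: "combination e (smult c p) = c *s combination e p"
  using combination_eq[of "smult c p" "degree p" e]
  by (simp add: combination_def scale_sum_right degree_smult_le)

lemma combination_monom: "combination e (monom c i) = c *s e (i + 2)"
proof -
  have "combination e (monom c i) = (\<Sum>j\<le>i. coeff (monom c i) j *s e (j + 2))"
    by (rule combination_eq) (rule degree_monom_le)
  also have "\<dots> = (\<Sum>j\<le>i. if j = i then c *s e (j + 2) else 0)"
    by (intro sum.cong) auto
  finally show ?thesis by simp
qed

lemma span_combination: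
  "span (e ` {1..}) = {c *s e 1 + combination e p | c p. True}" (is "_ = ?S")
proof
  have "subspace ?S"
  proof (rule subspaceI)
    have "0 = 0 *s e 1 + combination e 0" by (simp add: combination_def)
    then show "0 \<in> ?S" by blast
  next
    fix a b assume "a \<in> ?S" "b \<in> ?S"
    then obtain c d p q where "a = c *s e 1 + combination e p" "b = d *s e 1 + combination e q"
      by blast
    then have "a + b = (c + d) *s e 1 + combination e (p + q)"
      by (simp add: combination_add algebra_simps)
    then show "a + b \<in> ?S" by blast
  next
    fix k a assume "a \<in> ?S"
    then obtain c p where "a = c *s e 1 + combination e p" by blast
    then have "k *s a = (k * c) *s e 1 + combination e (smult k p)"
      by (simp add: combination_smult algebra_simps)
    then show "k *s a \<in> ?S" by blast
  qed
  moreover have "e i \<in> ?S" if i: "i \<ge> 1" for i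
  proof (cases "i = 1")
    case True
    then have "e i = 1 *s e 1 + combination e 0" by (simp add: combination_def)
    then show ?thesis by blast
  next
    case False
    then have "e i = 0 *s e 1 + combination e (monom 1 (i - 2))"
      using i by (simp add: combination_monom del: add_2_eq_Suc')
    then show ?thesis by blast
  qed
  ultimately show "span (e ` {1..}) \<subseteq> ?S" by (intro span_minimal) auto
  show "?S \<subseteq> span (e ` {1..})"
    by (auto simp: combination_def intro!: span_add span_scale span_sum intro: span_base)
qed

text \<open>The combination is rewritten as one sum over \<open>e ` {1..n}\<close>, to which the independence of the
  basis applies; \<open>d\<close> lists its coefficients.\<close>
lemma combination_independent:
  assumes inj: "inj_on e {1..}" and ind: "independent (e ` {1..})"
    and zero: "c *s e 1 + combination e p = 0"
  shows "c = 0 \<and> p = 0"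
proof -
  define n where "n = degree p + 2"
  define d where "d = (\<lambda>i. if i = 1 then c else coeff p (i - 2))"
  have "(\<Sum>i=1..n. d i *s e i) = d 1 *s e 1 + (\<Sum>i=0+2..degree p+2. d i *s e i)"
    by (simp add: n_def sum.atLeast_Suc_atMost numeral_2_eq_2)
  also have "(\<Sum>i=0+2..degree p+2. d i *s e i) = combination e p"
    unfolding sum.shift_bounds_cl_nat_ivl
    by (simp add: combination_def d_def atMost_atLeast0)
  finally have sum: "(\<Sum>i=1..n. d i *s e i) = 0" using zero by (simp add: d_def)
  have inj_n: "inj_on e {1..n}" using inj by (rule inj_on_subset) auto
  have "(\<Sum>v\<in>e ` {1..n}. d (the_inv_into {1..n} e v) *s v) = (\<Sum>i=1..n. d i *s e i)"
    unfolding sum.reindex[OF inj_n] by (intro sum.cong refl) (simp only: o_def the_inv_into_f_f[OF inj_n])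
  then have inv0: "d (the_inv_into {1..n} e (e i)) = 0" if "i \<in> {1..n}" for i
    using that sum by (intro independentD[OF ind, of "e ` {1..n}"]) auto
  then have d0: "d i = 0" if "i \<in> {1..n}" for i
    using inv0[OF that] by (simp only: the_inv_into_f_f[OF inj_n that])
  have "c = 0" using d0[of 1] by (simp add: d_def n_def)
  moreover have "coeff p i = 0" for i
    using d0[of "i + 2"] by (cases "i \<le> degree p") (auto simp: d_def n_def coeff_eq_0)
  ultimately show ?thesis by (simp add: poly_eqI)
qed

lemma combination_bracket_left:
  "\<lbrakk>combination e p, r\<rbrakk> = (\<Sum>i\<le>degree p. coeff p i *s \<lbrakk>e (i + 2), r\<rbrakk>)"
proof -
  have "\<lbrakk>sum f A, r\<rbrakk> = (\<Sum>i\<in>A. \<lbrakk>f i, r\<rbrakk>)" for f :: "nat \<Rightarrow> 'a" and A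
    by (induction A rule: infinite_finite_induct) (simp_all add: bracket_simps)
  then show ?thesis by (simp add: combination_def bracket_simps)
qed

lemma combination_bracket_right:
  "\<lbrakk>r, combination e p\<rbrakk> = (\<Sum>i\<le>degree p. coeff p i *s \<lbrakk>r, e (i + 2)\<rbrakk>)"
proof -
  have "\<lbrakk>r, sum f A\<rbrakk> = (\<Sum>i\<in>A. \<lbrakk>r, f i\<rbrakk>)" for f :: "nat \<Rightarrow> 'a" and A
    by (induction A rule: infinite_finite_induct) (simp_all add: bracket_simps)
  then show ?thesis by (simp add: combination_def bracket_simps)
qed

lemma combination_pCons:
  "combination e (pCons 0 p) = (\<Sum>i\<le>degree p. coeff p i *s e (i + 3))"
proof -
  have "combination e (pCons 0 p) = (\<Sum>i\<le>Suc (degree p). coeff (pCons 0 p) i *s e (i + 2))"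
    by (rule combination_eq) (rule degree_pCons_le)
  also have "\<dots> = (\<Sum>i\<le>degree p. coeff p i *s e (i + 3))"
    unfolding sum.atMost_Suc_shift by (simp add: eval_nat_numeral)
  finally show ?thesis .
qed

end

context leibniz_algebra
begin

lemma F_ideal_combination:
  assumes N: "ideal N" and inj: "inj_on e {1..}" and ind: "independent (e ` {1..})"
    and span: "span (e ` {1..}) = N"
    and table: "\<And>i j :: nat. i \<ge> 1 \<Longrightarrow> j \<ge> 1 \<Longrightarrow>
      \<lbrakk>e i, e j\<rbrakk> = (if i \<ge> 2 \<and> j = 1 then e (i + 1) else 0)"
  shows "F_ideal scale bracket N (e 1) (combination e)"
proof unfold_locales
  show "ideal N" by (rule N)
  show "N = {c *s e 1 + combination e p | c p. True}"
    using span span_combination by metis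
  show "c = 0 \<and> p = 0" if "c *s e 1 + combination e p = 0" for c p
    by (rule combination_independent[OF inj ind that])
  show "\<lbrakk>combination e p, combination e q\<rbrakk> = 0" for p q
    unfolding combination_bracket_left combination_bracket_right by (simp add: table)
  show "\<lbrakk>combination e p, e 1\<rbrakk> = combination e (pCons 0 p)" for p
    unfolding combination_bracket_left combination_pCons by (simp add: table eval_nat_numeral)
  show "\<lbrakk>e 1, combination e p\<rbrakk> = 0" for p
    unfolding combination_bracket_right by (simp add: table)
qed (simp_all add: table combination_add combination_smult)

section \<open>The multiplication table\<close>

text \<open>The basis of \<open>N\<close> is kept as it is, and \<open>\<beta>\<^sub>k\<close> is the coefficient of \<open>X\<^sup>k\<^sup>-\<^sup>2\<close> in the
  multiplier of \<open>x\<close>, because multiplication by \<open>X\<^sup>k\<^sup>-\<^sup>2\<close> sends \<open>e\<^sub>i\<close> to \<open>e\<^sub>k\<^sub>+\<^sub>i\<^sub>-\<^sub>2\<close>.\<close>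
lemma R_F_2_table_exists:
  assumes max: "maximal_pro_nilpotent_ideal N" and iso: "isomorphic_to_F N"
    and codim: "has_codim N UNIV 2"
  shows "\<exists>t\<ge>1. \<exists>\<beta> x y e. has_R_F_2_table t \<beta> x y e"
proof -
  \<comment> \<open>Rewriting \<open>e 1\<close> would hide the constants of the interpretation below, whose
    parameter it is.\<close>
  note One_nat_def [simp del]
  have N: "ideal N" and maximal: "\<And>J. ideal J \<Longrightarrow> pro_nilpotent J \<Longrightarrow> N \<subseteq> J \<Longrightarrow> J = N"
    using max by (auto simp: maximal_pro_nilpotent_ideal_def)
  obtain e :: "nat \<Rightarrow> 'a" where inj: "inj_on e {1..}" and ind: "independent (e ` {1..})"
    and span: "span (e ` {1..}) = N"
    and table: "\<And>i j :: nat. i \<ge> 1 \<Longrightarrow> j \<ge> 1 \<Longrightarrow>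
      \<lbrakk>e i, e j\<rbrakk> = (if i \<ge> 2 \<and> j = 1 then e (i + 1) else 0)"
    using iso unfolding isomorphic_to_F_def by blast
  interpret F_ideal scale bracket N "e 1" "combination e"
    using N inj ind span table by (rule F_ideal_combination)
  have nil: "r \<in> N" if "weight r = 0" "eigenvalue r = 0" for r
    using codim maximal that by (rule nil_elements_in_N)
  obtain x y where x: "weight x = 1" "eigenvalue x = 0" and y: "weight y = 0" "multiplier y = 1"
    and xe1: "\<lbrakk>x, e 1\<rbrakk> = - e 1" and ye1: "\<lbrakk>y, e 1\<rbrakk> = 0"
    and xy: "\<lbrakk>x, x\<rbrakk> = 0" "\<lbrakk>x, y\<rbrakk> = 0" "\<lbrakk>y, x\<rbrakk> = 0" "\<lbrakk>y, y\<rbrakk> = 0"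
    using normalized_complement[OF codim nil] by blast
  have y': "eigenvalue y = 1" by (simp add: eigenvalue_def y)
  have e_eq: "e i = combination e (monom 1 (i - 2))" if "i \<ge> 2" for i
    using that by (simp add: combination_monom del: add_2_eq_Suc')
  have notin: "x \<notin> span (insert y (e ` {1..}))" "y \<notin> span (e ` {1..})"
  proof -
    show "y \<notin> span (e ` {1..})" unfolding span using eigenvalue_N[of y] y' by auto
    show "x \<notin> span (insert y (e ` {1..}))"
    proof
      assume "x \<in> span (insert y (e ` {1..}))"
      then obtain c where "x - c *s y \<in> N" unfolding span_breakdown_eq span by blast
      then have "weight (x - c *s y) = 0" by (rule weight_N)
      then show False by (simp add: weight_diff weight_scale x y)
    qed
  qed
  have indep: "independent ({x, y} \<union> e ` {1..})"
    using notin ind by (simp add: independent_insertI)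
  have spans: "span ({x, y} \<union> e ` {1..}) = UNIV"
  proof -
    have "r \<in> span ({x, y} \<union> e ` {1..})" for r
    proof -
      have "r - weight r *s x - eigenvalue r *s y \<in> N"
        by (rule nil)
          (simp_all add: weight_diff weight_scale eigenvalue_diff eigenvalue_scale x y y')
      then show ?thesis unfolding Un_insert_left Un_empty_left span_breakdown_eq span by blast
    qed
    then show ?thesis by blast
  qed
  define b where "b = multiplier x"
  define t where "t = degree b + 2"
  define \<beta> where "\<beta> = (\<lambda>k. coeff b (k - 2))"
  have b_times: "combination e (b * monom 1 (i - 2)) = (\<Sum>k=2..t. \<beta> k *s e (k + i - 2))"
    if i: "i \<ge> 2" for i
  proof -
    have "b * monom 1 (i - 2) = (\<Sum>k\<le>degree b. monom (coeff b k) k) * monom 1 (i - 2)"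
      by (simp add: poly_as_sum_of_monoms)
    also have "\<dots> = (\<Sum>k\<le>degree b. monom (coeff b k) (k + i - 2))"
      using i by (simp add: sum_distrib_right mult_monom)
    finally have "combination e (b * monom 1 (i - 2))
        = (\<Sum>k\<le>degree b. coeff b k *s e (k + i))"
      using i by (simp add: \<phi>_sum combination_monom del: add_2_eq_Suc')
    also have "\<dots> = (\<Sum>k=0+2..degree b+2. \<beta> k *s e (k + i - 2))"
      unfolding sum.shift_bounds_cl_nat_ivl by (simp add: \<beta>_def atMost_atLeast0)
    finally show ?thesis by (simp only: t_def add_0)
  qed
  have ex: "\<lbrakk>e i, x\<rbrakk> = (of_nat i - 2) *s e i + (\<Sum>k=2..t. \<beta> k *s e (k + i - 2))"
    if i: "i \<ge> 2" for i
  proof -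
    have "pCons 0 (pderiv (monom 1 j)) = monom (of_nat j :: complex) j" for j
      by (cases j) (simp_all add: pderiv_monom flip: monom_Suc)
    then have "pCons 0 (pderiv (monom 1 (i - 2))) = monom (of_nat i - 2 :: complex) (i - 2)"
      using i by (simp add: of_nat_diff)
    then have "\<lbrakk>e i, x\<rbrakk> = combination e (monom (of_nat i - 2) (i - 2) + b * monom 1 (i - 2))"
      unfolding e_eq[OF i] \<phi>_bracket by (simp add: x b_def)
    then show ?thesis unfolding combination_add b_times[OF i] combination_monom using i
      by (simp del: add_2_eq_Suc')
  qed
  have ey: "\<lbrakk>e i, y\<rbrakk> = e i" if "i \<ge> 2" for i
    unfolding e_eq[OF that] \<phi>_bracket by (simp add: y)
  have re: "\<lbrakk>r, e i\<rbrakk> = 0" if "i \<ge> 2" for r i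
    unfolding e_eq[OF that] by (rule bracket_\<phi>)
  have "has_R_F_2_table t \<beta> x y e"
    unfolding has_R_F_2_table_def
  proof (intro conjI)
    show "x \<noteq> y" "x \<notin> e ` {1..}" "y \<notin> e ` {1..}"
      using notin by (auto intro: span_base)
    show "\<forall>i\<ge>1. \<lbrakk>y, e i\<rbrakk> = 0"
    proof (intro allI impI)
      fix i :: nat assume "i \<ge> 1"
      then show "\<lbrakk>y, e i\<rbrakk> = 0" using ye1 re[of i y] by (cases "i = 1") auto
    qed
    show "\<lbrakk>e 1, x\<rbrakk> = e 1" "\<lbrakk>e 1, y\<rbrakk> = 0" by (simp_all add: e1_bracket x y)
    show "\<forall>i\<ge>1. \<forall>j\<ge>1. \<lbrakk>e i, e j\<rbrakk> = (if i \<ge> 2 \<and> j = 1 then e (i + 1) else 0)"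
      using table by blast
  qed (use inj indep spans xe1 ex ey re xy in blast)+
  moreover have "t \<ge> 1" by (simp add: t_def)
  ultimately show ?thesis by blast
qed

end

theorem theorem3p10:
  fixes scale :: "complex \<Rightarrow> 'a::ab_group_add \<Rightarrow> 'a"
    and bracket :: "'a \<Rightarrow> 'a \<Rightarrow> 'a"
    and N :: "'a set"
  assumes "leibniz_algebra scale bracket"
    and "complex_algebra.residually_solvable scale bracket (UNIV :: 'a set)"
    and "complex_algebra.maximal_pro_nilpotent_ideal scale bracket N"
    and "complex_algebra.isomorphic_to_F scale bracket N"
    and "complex_algebra.has_codim scale N UNIV 2"
  shows "\<exists>(t::nat)\<ge>1. \<exists>(\<beta> :: nat \<Rightarrow> complex) x y (e :: nat \<Rightarrow> 'a).
    complex_algebra.has_R_F_2_table scale bracket t \<beta> x y e"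
  using leibniz_algebra.R_F_2_table_exists[OF assms(1,3-5)] .

end
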